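(* Let $F:\mathbb{R}^2\times\mathbb{R}\to\mathbb{R}$, $(x,y,\alpha)\mapsto F(x,y,\alpha)$, be of class $\mathcal{C}^3$, and let $f:U\to\mathbb{R}$ be of class $\mathcal{C}^3$ on an open set $U\subset\mathbb{R}^2$ with $F(x,f(x,\alpha),\alpha)=0$ for all $(x,\alpha)\in U$. (1) Let $k\ge1$ and let $(x,\alpha)$ be such that the iterates $f^{j}=f^{j}(x,\alpha)$, $0\le j\le k$, are defined (that is, $(f^j,\alpha)\in U$ for $0\le j\le k-1$), with $F_y^{j}\ne0$ and $F_x^{j}\neq 0$ for $0\le j\le k-1$. Then at $(x,\alpha)$ $$\begin{aligned}\partial_{x^3}f^{k}={}&\frac{(\partial_{x^2}f^{k})^2}{\partial_x f^{k}}+\partial_x f^{k}\sum_{j=0}^{k-1}\frac{F_{x^2}^{j}-2F_{xy}^{j}\nu_j+F_{y^2}^{j}\nu_j^2}{F_x^{j}}\,\partial_{x^2} f^{j}\\&+\partial_x f^{k}\sum_{j=0}^{k-1}\frac{F_{x^3}^{j}-3F_{x^2y}^{j}\nu_j+3F_{xy^2}^{j}\nu_j^2-F_{y^3}^{j}\nu_j^3}{F_x^{j}}\,(\partial_x f^{j})^2\\&+\partial_x f^{k}\sum_{j=0}^{k-1}\Big(-(F_{x^2}^{j})^2+F_{x^2}^{j}F_{xy}^{j}\nu_j+\big(F_{x^2}^{j}F_{y^2}^{j}+2(F_{xy}^{j})^2\big)\nu_j^2-5F_{xy}^{j}F_{y^2}^{j}\nu_j^3+2(F_{y^2}^{j})^2\nu_j^4\Big)\left(\frac{\partial_x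 f^{j}}{F_x^{j}}\right)^2 .\end{aligned}$$ (2) Let $x_0$ be a periodic point of period $p\ge 1$ of $f(\cdot,\alpha)$, with orbit $x_j=f^j(x_0,\alpha)$, $(x_j,\alpha)\in U$ for $0\le j\le p-1$, $x_p=x_0$, $F_y(x_j,x_{j+1},\alpha)\neq0$ for $0\le j\le p-1$, and $\partial_x f^{p}(x_0,\alpha)=\varepsilon$ with $\varepsilon\in\{1,-1\}$. Then at $(x_0,\alpha)$ $$\begin{aligned}\partial_{x^3}f^{p}={}&\varepsilon(\partial_{x^2}f^{p})^2+\varepsilon\sum_{j=0}^{p-1}\frac{\widetilde F_{x^2}^{j}-2\widetilde F_{xy}^{j}\widetilde\nu_j+\widetilde F_{y^2}^{j}\widetilde\nu_j^2}{\widetilde F_x^{j}}\,\partial_{x^2} f^{j}\\&+\varepsilon\sum_{j=0}^{p-1}\frac{\widetilde F_{x^3}^{j}-3\widetilde F_{x^2y}^{j}\widetilde\nu_j+3\widetilde F_{xy^2}^{j}\widetilde\nu_j^2-\widetilde F_{y^3}^{j}\widetilde\nu_j^3}{\widetilde F_x^{j}}\,(\partial_x f^{j})^2\\&+\varepsilon\sum_{j=0}^{p-1}\frac{-(\widetilde F_{x^2}^{j})^2+\widetilde F_{x^2}^{j}\widetilde F_{xy}^{j}\widetilde\nu_j+\big(\widetilde F_{x^2}^{j}\widetilde F_{y^2}^{j}+2(\widetilde F_{xy}^{j})^2\big)\widetilde\nu_j^2-5\widetilde F_{xy}^{j}\widetilde F_{y^2}^{j}\widetilde\nu_j^3+2(\widetilde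 F_{y^2}^{j})^2\widetilde\nu_j^4}{(\widetilde F_x^{j})^2}\,(\partial_x f^{j})^2 .\end{aligned}$$
   Context: The equation $F(x_n,x_{n+1},\alpha)=0$ defines implicitly a one-dimensional discrete dynamical system $x_{n+1}=f(x_n,\alpha)$, where $\alpha$ is a real parameter. $f^{i}$ denotes the $i$-fold composition of $f$ in the dynamic variable with the parameter fixed: $f^{0}(x,\alpha)=x$, $f^{i+1}(x,\alpha)=f(f^{i}(x,\alpha),\alpha)$. Subscripts on $F$ denote partial derivatives with respect to its first argument $x$ and second argument $y$ (e.g. $F_{x^2}=F_{xx}$, $F_{x^2y}=F_{xxy}$, $F_{y^3}=F_{yyy}$). A superscript $j$ on a derivative of $F$ is an index meaning evaluation at $(f^{j}(x,\alpha),f^{j+1}(x,\alpha),\alpha)$, and with a tilde it means evaluation at $(x_j,x_{j+1},\alpha)$; powers of these are written with parentheses, while powers of $\nu_j,\widetilde\nu_j$ are ordinary powers. $\nu_j=F_x^{j}/F_y^{j}$ and $\widetilde\nu_j=\widetilde F_x^{j}/\widetilde F_y^{j}$. $\partial_x f^{j}$, $\partial_{x^2}f^{j}$, $\partial_{x^3}f^{j}$ are the first, second and third partial derivatives of $(x,\alpha)\mapsto f^{j}(x,\alpha)$ with respect to $x$ (so $\partial_x f^{0}=1$, $\partial_{x^2}f^{0}=0$); in (2) they are evaluated at $(x_0,\alpha)$. In (2) the quantities $\widetilde F_x^j$ are automatically nonzero, since $\partial_xf^p(x_0,\alpha)=\pm1$. *)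

theory Defs
  imports "HOL-Analysis.Analysis"
begin

text \<open>
  Class \<open>C^n\<close> on a set, meant for open sets: all iterated directional derivatives up to
  order \<open>n\<close> exist as Frechet derivatives and are continuous. Since
  derivatives are taken with the full filter \<open>at x\<close>, the values of \<open>g\<close> outside
  an open \<open>S\<close> do not matter.
\<close>

primrec C_class_on ::
    "nat \<Rightarrow> 'a::real_normed_vector set \<Rightarrow> ('a \<Rightarrow> 'b::real_normed_vector) \<Rightarrow> bool" where
  "C_class_on 0 S g \<longleftrightarrow> continuous_on S g"
| "C_class_on (Suc n) S g \<longleftrightarrow>
     (\<forall>x\<in>S. g differentiable (at x)) \<and>
     (\<forall>v. C_class_on n S (\<lambda>x. frechet_derivative g (at x) v))"

text \<open>
  The partial derivative in the first argument is polymorphic in the remaining ones, so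
  that it applies both to \<open>F(x, y, \<alpha>)\<close> and to the iterates \<open>f\<^sup>j(x, \<alpha>)\<close>.
\<close>

definition pd_x :: "(real \<times> 'b \<Rightarrow> real) \<Rightarrow> real \<times> 'b \<Rightarrow> real" where
  "pd_x g = (\<lambda>(x, c). deriv (\<lambda>t. g (t, c)) x)"

definition pd_y :: "(real \<times> real \<times> 'b \<Rightarrow> real) \<Rightarrow> real \<times> real \<times> 'b \<Rightarrow> real" where
  "pd_y g = (\<lambda>(x, y, c). deriv (\<lambda>t. g (x, t, c)) y)"

text \<open>
  Iteration in the dynamic variable with the parameter fixed. The map \<open>f\<close> is total here;
  \<open>f\<^sup>j(x, \<alpha>)\<close> is meaningful only if \<open>(f\<^sup>i(x, \<alpha>), \<alpha>)\<close> lies in the domain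
  of \<open>f\<close> for all \<open>i < j\<close>.
\<close>

primrec iter :: "(real \<times> real \<Rightarrow> real) \<Rightarrow> nat \<Rightarrow> real \<times> real \<Rightarrow> real" where
  "iter f 0 z = fst z"
| "iter f (Suc i) z = f (iter f i z, snd z)"

end

theory Submission
  imports Defs
begin

text \<open>
  The formula is the second logarithmic derivative of the chain rule. Write \<open>g = f(\<cdot>, \<alpha>)\<close>
  and \<open>\<phi>\<^sub>j = f\<^sup>j(\<cdot>, \<alpha>)\<close>, so that \<open>\<phi>\<^sub>k' = \<Prod>j<k. g'(\<phi>\<^sub>j)\<close>. As long as this product does not
  vanish, \<open>log \<bar>\<phi>\<^sub>k'\<bar>\<close> is a sum, and differentiating it twice gives
  \<open>\<phi>\<^sub>k''' / \<phi>\<^sub>k' - (\<phi>\<^sub>k'' / \<phi>\<^sub>k')\<^sup>2 =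
    (\<Sum>j<k. (log \<bar>g'\<bar>)'(\<phi>\<^sub>j) \<phi>\<^sub>j'' + (log \<bar>g'\<bar>)''(\<phi>\<^sub>j) (\<phi>\<^sub>j')\<^sup>2)\<close>.
  In the proof the logarithm appears only through this identity, which is obtained by
  induction from the chain rules of orders one to three
  (\<open>third_derivative_of_composition_chain\<close>, \<open>pd_x_iter_Suc\<close>).

  The logarithmic derivatives of \<open>g'\<close> are read off from \<open>F(x, g(x), \<alpha>) = 0\<close>, differentiated
  three times (\<open>implicit_jet3_equations\<close>). Each of the three equations is linear in the highest
  derivative of \<open>g\<close>, with coefficient \<open>F\<^sub>y \<noteq> 0\<close>. The first gives \<open>g' = - \<nu>\<close>, and division by \<open>g'\<close>
  turns the denominator \<open>F\<^sub>y\<close> into \<open>F\<^sub>x\<close> (\<open>implicit_log_derivatives\<close>). The differentiated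
  equations produce mixed derivatives of \<open>F\<close> with the variables in different orders, and the symmetry of second
  derivatives (\<open>pd_x_pd_y_commute\<close>) identifies them.

  In both parts the product for \<open>\<phi>\<^sub>k'\<close> is nonzero exactly when \<open>F\<^sub>x\<close> vanishes nowhere along the
  orbit (\<open>pd_x_iter_nonzero_iff\<close>). For a cycle this is a consequence of \<open>\<phi>\<^sub>p' = \<epsilon> \<noteq> 0\<close>, and
  the second formula is the first with \<open>1 / \<epsilon> = \<epsilon>\<close>.
\<close>

section \<open>Partial derivatives of functions of class \<open>C^n\<close>\<close>

text \<open>
  The class is defined through Frechet derivatives in fixed directions, which agree with the
  partial derivatives at the points of differentiability, that is, on \<open>S\<close> but perhaps not
  elsewhere. This congruence allows the one to be replaced by the other.
\<close>

lemma C_class_on_cong: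
  assumes "open S" "\<And>x. x \<in> S \<Longrightarrow> g x = h x" "C_class_on n S g"
  shows "C_class_on n S h"
  using assms(2,3)
proof (induction n arbitrary: g h)
  case 0
  then show ?case
    by (metis C_class_on.simps(1) continuous_on_cong)
next
  case (Suc n)
  have diff: "\<forall>x\<in>S. g differentiable (at x)"
    using Suc.prems by simp
  have "h differentiable (at x)" if "x \<in> S" for x
    using diff that Suc.prems(1) \<open>open S\<close>
    unfolding differentiable_def by (meson has_derivative_transform_within_open)
  moreover have "C_class_on n S (\<lambda>x. frechet_derivative h (at x) v)" for v
  proof (rule Suc.IH)
    show "C_class_on n S (\<lambda>x. frechet_derivative g (at x) v)"
      using Suc.prems by simp
    show "frechet_derivative g (at x) v = frechet_derivative h (at x) v" if "x \<in> S" for x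
      using frechet_derivative_transform_within_open[of g x S h] diff that Suc.prems(1) \<open>open S\<close>
      by auto
  qed
  ultimately show ?case
    by simp
qed

lemma C_class_on_imp_differentiable:
  "C_class_on (Suc n) S g \<Longrightarrow> z \<in> S \<Longrightarrow> g differentiable (at z)"
  by simp

lemma C_class_on_imp_continuous_on: "C_class_on n S g \<Longrightarrow> continuous_on S g"
  by (cases n)
    (auto intro!: continuous_at_imp_continuous_on differentiable_imp_continuous_within)

lemma has_field_derivative_along:
  fixes g :: "'a::real_normed_vector \<Rightarrow> real"
  assumes "g differentiable (at (\<gamma> t))" "(\<gamma> has_vector_derivative v) (at t)"
  shows "((\<lambda>s. g (\<gamma> s)) has_real_derivative frechet_derivative g (at (\<gamma> t)) v) (at t)"
proof -
  have D: "(g has_derivative frechet_derivative g (at (\<gamma> t))) (at (\<gamma> t))"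
    using assms(1) frechet_derivative_works by blast
  then interpret bounded_linear "frechet_derivative g (at (\<gamma> t))"
    by (rule has_derivative_bounded_linear)
  have "((\<lambda>s. g (\<gamma> s)) has_derivative (\<lambda>s. frechet_derivative g (at (\<gamma> t)) (s *\<^sub>R v))) (at t)"
    using diff_chain_at[OF assms(2)[unfolded has_vector_derivative_def] D]
    by (simp add: o_def)
  then show ?thesis
    unfolding has_field_derivative_def by (simp add: scaleR mult_commute_abs)
qed

lemma has_real_derivative_pd_x:
  assumes "g differentiable (at (x, c))"
  shows "((\<lambda>t. g (t, c)) has_real_derivative pd_x g (x, c)) (at x)"
    and "pd_x g (x, c) = frechet_derivative g (at (x, c)) (1, 0)"
proof -
  have "((\<lambda>t. (t, c)) has_vector_derivative (1, 0)) (at x)"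
    by (auto intro!: derivative_eq_intros simp: has_vector_derivative_def)
  then have D: "((\<lambda>t. g (t, c)) has_real_derivative
      frechet_derivative g (at (x, c)) (1, 0)) (at x)"
    using assms by (intro has_field_derivative_along)
  then show eq: "pd_x g (x, c) = frechet_derivative g (at (x, c)) (1, 0)"
    by (simp add: pd_x_def DERIV_imp_deriv)
  show "((\<lambda>t. g (t, c)) has_real_derivative pd_x g (x, c)) (at x)"
    unfolding eq by (rule D)
qed

lemma has_real_derivative_pd_y:
  fixes g :: "real \<times> real \<times> 'b::real_normed_vector \<Rightarrow> real"
  assumes "g differentiable (at (x, y, c))"
  shows "((\<lambda>t. g (x, t, c)) has_real_derivative pd_y g (x, y, c)) (at y)"
    and "pd_y g (x, y, c) = frechet_derivative g (at (x, y, c)) (0, 1, 0)"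
proof -
  have "((\<lambda>t. (x, t, c)) has_vector_derivative (0, 1, 0)) (at y)"
    by (auto intro!: derivative_eq_intros simp: has_vector_derivative_def)
  then have D: "((\<lambda>t. g (x, t, c)) has_real_derivative
      frechet_derivative g (at (x, y, c)) (0, 1, 0)) (at y)"
    using assms by (intro has_field_derivative_along)
  then show eq: "pd_y g (x, y, c) = frechet_derivative g (at (x, y, c)) (0, 1, 0)"
    by (simp add: pd_y_def DERIV_imp_deriv)
  show "((\<lambda>t. g (x, t, c)) has_real_derivative pd_y g (x, y, c)) (at y)"
    unfolding eq by (rule D)
qed

lemma C_class_on_pd_x:
  assumes "open S" "C_class_on (Suc n) S g"
  shows "C_class_on n S (pd_x g)"
proof (rule C_class_on_cong[OF \<open>open S\<close>])
  show "C_class_on n S (\<lambda>z. frechet_derivative g (at z) (1, 0))"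
    using assms by simp
  show "frechet_derivative g (at z) (1, 0) = pd_x g z" if "z \<in> S" for z
    using has_real_derivative_pd_x(2)[of g "fst z" "snd z"] that assms by simp
qed

lemma C_class_on_pd_y:
  fixes g :: "real \<times> real \<times> 'b::real_normed_vector \<Rightarrow> real"
  assumes "open S" "C_class_on (Suc n) S g"
  shows "C_class_on n S (pd_y g)"
proof (rule C_class_on_cong[OF \<open>open S\<close>])
  show "C_class_on n S (\<lambda>z. frechet_derivative g (at z) (0, 1, 0))"
    using assms by simp
  show "frechet_derivative g (at z) (0, 1, 0) = pd_y g z" if "z \<in> S" for z
    using has_real_derivative_pd_y(2)[of g "fst z" "fst (snd z)" "snd (snd z)"] that assms by simp
qed

lemma has_real_derivative_along_graph:
  fixes H :: "real \<times> real \<times> 'b::real_normed_vector \<Rightarrow> real"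
  assumes "H differentiable (at (t, g t, c))" "(g has_real_derivative d) (at t)"
  shows "((\<lambda>s. H (s, g s, c)) has_real_derivative
    pd_x H (t, g t, c) + pd_y H (t, g t, c) * d) (at t)"
proof -
  let ?L = "frechet_derivative H (at (t, g t, c))"
  have "(g has_derivative (\<lambda>s. s * d)) (at t)"
    using assms(2) by (simp add: has_field_derivative_def mult_commute_abs)
  then have "((\<lambda>s. (s, g s, c)) has_vector_derivative (1, d, 0)) (at t)"
    unfolding has_vector_derivative_def
    by (auto intro!: derivative_eq_intros)
  then have "((\<lambda>s. H (s, g s, c)) has_real_derivative ?L (1, d, 0)) (at t)"
    using assms(1) by (intro has_field_derivative_along)
  moreover have "?L (1, d, 0) = pd_x H (t, g t, c) + pd_y H (t, g t, c) * d"
  proof -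
    interpret bounded_linear ?L
      using assms(1) frechet_derivative_works has_derivative_bounded_linear by blast
    have "?L (1, d, 0) = ?L ((1, 0) + d *\<^sub>R (0, 1, 0))"
      by (simp add: zero_prod_def)
    also have "\<dots> = ?L (1, 0) + d * ?L (0, 1, 0)"
      by (simp only: add scaleR real_scaleR_def)
    finally show ?thesis
      using assms(1) by (simp add: has_real_derivative_pd_x(2) has_real_derivative_pd_y(2))
  qed
  ultimately show ?thesis
    by simp
qed

text \<open>
  Two applications of the mean value theorem turn the second difference over a square into a
  value of the mixed derivative. The left-hand side does not change when the two variables are
  exchanged, which is why the order of differentiation is immaterial in the limit.
\<close>

lemma second_difference_mean_value:
  fixes G G1 G12 :: "real \<Rightarrow> real \<Rightarrow> real"
  assumes G1: "\<And>s t. ((\<lambda>s. G s t) has_real_derivative G1 s t) (at s)"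
    and G12: "\<And>s t. (G1 s has_real_derivative G12 s t) (at t)"
    and "h > 0"
  shows "\<exists>\<xi> \<eta>. a < \<xi> \<and> \<xi> < a + h \<and> b < \<eta> \<and> \<eta> < b + h \<and>
    G (a + h) (b + h) - G (a + h) b - G a (b + h) + G a b = h * h * G12 \<xi> \<eta>"
proof -
  have "\<exists>\<xi>. a < \<xi> \<and> \<xi> < a + h \<and> (G (a + h) (b + h) - G (a + h) b) - (G a (b + h) - G a b)
      = (a + h - a) * (G1 \<xi> (b + h) - G1 \<xi> b)"
    using \<open>h > 0\<close> by (intro MVT2) (auto intro!: DERIV_diff G1)
  then obtain \<xi> where \<xi>: "a < \<xi>" "\<xi> < a + h"
      "G (a + h) (b + h) - G (a + h) b - (G a (b + h) - G a b)
        = h * (G1 \<xi> (b + h) - G1 \<xi> b)"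
    by auto
  have "\<exists>\<eta>. b < \<eta> \<and> \<eta> < b + h \<and> G1 \<xi> (b + h) - G1 \<xi> b = (b + h - b) * G12 \<xi> \<eta>"
    using \<open>h > 0\<close> by (intro MVT2) (auto intro!: G12)
  then obtain \<eta> where "b < \<eta>" "\<eta> < b + h" "G1 \<xi> (b + h) - G1 \<xi> b = h * G12 \<xi> \<eta>"
    by auto
  then show ?thesis
    using \<xi> by (intro exI[of _ \<xi>] exI[of _ \<eta>]) (simp add: algebra_simps)
qed

text \<open>
  Compare the two mean values of the second difference on squares that shrink to the point,
  and use the continuity of the mixed derivatives.
\<close>

proposition pd_x_pd_y_commute:
  fixes H :: "real \<times> real \<times> 'b::real_normed_vector \<Rightarrow> real"
  assumes C2: "C_class_on (Suc (Suc n)) UNIV H"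
  shows "pd_x (pd_y H) = pd_y (pd_x H)"
proof
  fix z :: "real \<times> real \<times> 'b"
  obtain a b c where z: "z = (a, b, c)"
    by (cases z) auto
  note Cx = C_class_on_pd_x[OF open_UNIV C2] and Cy = C_class_on_pd_y[OF open_UNIV C2]
  note diff = C_class_on_imp_differentiable[OF C2 UNIV_I]
    C_class_on_imp_differentiable[OF Cx UNIV_I] C_class_on_imp_differentiable[OF Cy UNIV_I]
  define \<Delta> where "\<Delta> h = H (a + h, b + h, c) - H (a + h, b, c) - H (a, b + h, c) + H (a, b, c)"
    for h
  define h where "h n = inverse (real (Suc n))" for n
  have h_pos: "h n > 0" for n
    by (simp add: h_def)
  have "h \<longlonglongrightarrow> 0"
    unfolding h_def by (rule LIMSEQ_inverse_real_of_nat)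
  then have lim_ah: "(\<lambda>n. u + h n) \<longlonglongrightarrow> u" for u
    using tendsto_add[OF tendsto_const] by fastforce
  \<comment> \<open>Sampling a continuous function inside squares that shrink to a point.\<close>
  have lim: "(\<lambda>n. K (\<xi> n, \<eta> n, c)) \<longlonglongrightarrow> K (a, b, c)"
    if K: "continuous_on UNIV K"
      and "\<And>n. a < \<xi> n \<and> \<xi> n < a + h n \<and> b < \<eta> n \<and> \<eta> n < b + h n"
    for K :: "real \<times> real \<times> 'b \<Rightarrow> real" and \<xi> \<eta> :: "nat \<Rightarrow> real"
  proof (rule continuous_on_tendsto_compose[OF K])
    have "\<xi> \<longlonglongrightarrow> a" "\<eta> \<longlonglongrightarrow> b"
      using that(2)
      by (auto intro!: tendsto_sandwich[OF _ _ tendsto_const lim_ah] always_eventually less_imp_le)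
    then show "(\<lambda>n. (\<xi> n, \<eta> n, c)) \<longlonglongrightarrow> (a, b, c)"
      by (intro tendsto_intros)
  qed auto
  have "\<exists>\<xi> \<eta>. a < \<xi> \<and> \<xi> < a + h n \<and> b < \<eta> \<and> \<eta> < b + h n \<and>
      \<Delta> (h n) = h n * h n * pd_y (pd_x H) (\<xi>, \<eta>, c)" for n
    unfolding \<Delta>_def
    by (rule second_difference_mean_value[where ?G1.0 = "\<lambda>s t. pd_x H (s, t, c)"])
      (auto intro!: has_real_derivative_pd_x has_real_derivative_pd_y diff h_pos)
  then obtain \<xi> \<eta> where xy: "\<And>n. a < \<xi> n \<and> \<xi> n < a + h n \<and> b < \<eta> n \<and> \<eta> n < b + h n"
      and xy_eq: "\<And>n. \<Delta> (h n) = h n * h n * pd_y (pd_x H) (\<xi> n, \<eta> n, c)"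
    by metis
  have "\<exists>\<eta> \<xi>. b < \<eta> \<and> \<eta> < b + h n \<and> a < \<xi> \<and> \<xi> < a + h n \<and>
      H (a + h n, b + h n, c) - H (a, b + h n, c) - H (a + h n, b, c) + H (a, b, c)
        = h n * h n * pd_x (pd_y H) (\<xi>, \<eta>, c)" for n
    by (rule second_difference_mean_value[where ?G1.0 = "\<lambda>t s. pd_y H (s, t, c)"
            and G = "\<lambda>t s. H (s, t, c)"])
      (auto intro!: has_real_derivative_pd_x has_real_derivative_pd_y diff h_pos)
  then have "\<exists>\<xi> \<eta>. (a < \<xi> \<and> \<xi> < a + h n \<and> b < \<eta> \<and> \<eta> < b + h n) \<and>
      \<Delta> (h n) = h n * h n * pd_x (pd_y H) (\<xi>, \<eta>, c)" for n
    unfolding \<Delta>_def by (smt (verit))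
  then obtain \<xi>' \<eta>' where yx: "\<And>n. a < \<xi>' n \<and> \<xi>' n < a + h n \<and> b < \<eta>' n \<and> \<eta>' n < b + h n"
      and yx_eq: "\<And>n. \<Delta> (h n) = h n * h n * pd_x (pd_y H) (\<xi>' n, \<eta>' n, c)"
    by metis
  have "pd_y (pd_x H) (\<xi> n, \<eta> n, c) = pd_x (pd_y H) (\<xi>' n, \<eta>' n, c)" for n
    using xy_eq[of n] yx_eq[of n] h_pos[of n] by simp
  moreover have "(\<lambda>n. pd_y (pd_x H) (\<xi> n, \<eta> n, c)) \<longlonglongrightarrow> pd_y (pd_x H) (a, b, c)"
    using xy C_class_on_pd_y[OF open_UNIV Cx] by (intro lim C_class_on_imp_continuous_on)
  moreover have "(\<lambda>n. pd_x (pd_y H) (\<xi>' n, \<eta>' n, c)) \<longlonglongrightarrow> pd_x (pd_y H) (a, b, c)"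
    using yx C_class_on_pd_x[OF open_UNIV Cy] by (intro lim C_class_on_imp_continuous_on)
  ultimately show "pd_x (pd_y H) z = pd_y (pd_x H) z"
    unfolding z using LIMSEQ_unique by fastforce
qed

section \<open>Three-jets of functions of one variable\<close>

text \<open>
  The derivatives are recorded as explicit values, so that composing two jets is a
  computation with numbers and differentiability of the result comes with it. The lower
  derivatives must exist around the point, since they are differentiated once more.
\<close>

definition jet3 :: "(real \<Rightarrow> real) \<Rightarrow> real \<Rightarrow> real \<Rightarrow> real \<Rightarrow> real \<Rightarrow> bool" where
  "jet3 \<phi> x a b c \<longleftrightarrow> (\<exists>\<phi>1 \<phi>2.
     (\<forall>\<^sub>F t in nhds x. (\<phi> has_real_derivative \<phi>1 t) (at t)) \<and>
     (\<forall>\<^sub>F t in nhds x. (\<phi>1 has_real_derivative \<phi>2 t) (at t)) \<and>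
     (\<phi>2 has_real_derivative c) (at x) \<and> \<phi>1 x = a \<and> \<phi>2 x = b)"

lemma DERIV_deriv_of_eventually:
  assumes "\<forall>\<^sub>F t in nhds x. (\<phi> has_real_derivative \<phi>1 t) (at t)"
    and "(\<phi>1 has_real_derivative b) (at x)"
  shows "(deriv \<phi> has_real_derivative b) (at x)"
proof -
  have "\<forall>\<^sub>F t in nhds x. deriv \<phi> t = \<phi>1 t"
    using assms(1) by eventually_elim (rule DERIV_imp_deriv)
  then show ?thesis
    using assms(2) DERIV_cong_ev by blast
qed

lemma jet3_imp_deriv:
  assumes "jet3 \<phi> x a b c"
  shows "deriv \<phi> x = a" "deriv (deriv \<phi>) x = b" "deriv (deriv (deriv \<phi>)) x = c"
proof -
  obtain \<phi>1 \<phi>2 where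
    1: "\<forall>\<^sub>F t in nhds x. (\<phi> has_real_derivative \<phi>1 t) (at t)" and
    2: "\<forall>\<^sub>F t in nhds x. (\<phi>1 has_real_derivative \<phi>2 t) (at t)" and
    3: "(\<phi>2 has_real_derivative c) (at x)" "\<phi>1 x = a" "\<phi>2 x = b"
    using assms unfolding jet3_def by blast
  show "deriv \<phi> x = a"
    using eventually_nhds_x_imp_x[OF 1] 3 by (auto intro: DERIV_imp_deriv)
  have "\<forall>\<^sub>F s in nhds x. \<forall>\<^sub>F t in nhds s. (\<phi> has_real_derivative \<phi>1 t) (at t)"
    using 1 by (simp add: eventually_eventually)
  then have deriv2: "\<forall>\<^sub>F t in nhds x. (deriv \<phi> has_real_derivative \<phi>2 t) (at t)"
    using 2 by eventually_elim (rule DERIV_deriv_of_eventually)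
  show "deriv (deriv \<phi>) x = b"
    using eventually_nhds_x_imp_x[OF deriv2] 3 by (auto intro: DERIV_imp_deriv)
  show "deriv (deriv (deriv \<phi>)) x = c"
    using DERIV_deriv_of_eventually[OF deriv2 3(1)] by (rule DERIV_imp_deriv)
qed

lemma jet3_ident: "jet3 (\<lambda>t. t) x 1 0 0"
  unfolding jet3_def by (rule exI[of _ "\<lambda>_. 1"], rule exI[of _ "\<lambda>_. 0"]) auto

lemma jet3_compose:
  assumes "jet3 \<phi> x a b c" "jet3 \<psi> (\<phi> x) p q r"
  shows "jet3 (\<lambda>t. \<psi> (\<phi> t)) x (p * a) (q * a\<^sup>2 + p * b) (r * a ^ 3 + 3 * q * a * b + p * c)"
proof -
  obtain \<phi>1 \<phi>2 where
    \<phi>: "\<forall>\<^sub>F t in nhds x. (\<phi> has_real_derivative \<phi>1 t) (at t)"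
    "\<forall>\<^sub>F t in nhds x. (\<phi>1 has_real_derivative \<phi>2 t) (at t)"
    "(\<phi>2 has_real_derivative c) (at x)" "\<phi>1 x = a" "\<phi>2 x = b"
    using assms unfolding jet3_def by blast
  obtain \<psi>1 \<psi>2 where
    \<psi>: "\<forall>\<^sub>F t in nhds (\<phi> x). (\<psi> has_real_derivative \<psi>1 t) (at t)"
    "\<forall>\<^sub>F t in nhds (\<phi> x). (\<psi>1 has_real_derivative \<psi>2 t) (at t)"
    "(\<psi>2 has_real_derivative r) (at (\<phi> x))" "\<psi>1 (\<phi> x) = p" "\<psi>2 (\<phi> x) = q"
    using assms unfolding jet3_def by blast
  have D: "(\<phi> has_real_derivative \<phi>1 x) (at x)" "(\<phi>1 has_real_derivative \<phi>2 x) (at x)"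
    "(\<psi>1 has_real_derivative \<psi>2 (\<phi> x)) (at (\<phi> x))"
    using \<phi> \<psi> eventually_nhds_x_imp_x by blast+
  have "filterlim \<phi> (nhds (\<phi> x)) (nhds x)"
    using DERIV_isCont[OF D(1)] by (simp add: isCont_def tendsto_at_iff_tendsto_nhds)
  then have \<psi>': "\<forall>\<^sub>F t in nhds x. (\<psi> has_real_derivative \<psi>1 (\<phi> t)) (at (\<phi> t))"
    "\<forall>\<^sub>F t in nhds x. (\<psi>1 has_real_derivative \<psi>2 (\<phi> t)) (at (\<phi> t))"
    using \<psi> by (auto intro: eventually_compose_filterlim)
  show ?thesis
    unfolding jet3_def
  proof (intro exI conjI)
    show "\<forall>\<^sub>F t in nhds x. ((\<lambda>t. \<psi> (\<phi> t)) has_real_derivative \<psi>1 (\<phi> t) * \<phi>1 t) (at t)"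
      using \<psi>'(1) \<phi>(1) by eventually_elim (rule DERIV_chain2)
    show "\<forall>\<^sub>F t in nhds x. ((\<lambda>t. \<psi>1 (\<phi> t) * \<phi>1 t) has_real_derivative
        \<psi>2 (\<phi> t) * (\<phi>1 t)\<^sup>2 + \<psi>1 (\<phi> t) * \<phi>2 t) (at t)"
      using \<psi>'(2) \<phi>(1,2)
      by eventually_elim
        (auto intro!: derivative_eq_intros DERIV_chain2[of \<psi>1] simp: power2_eq_square)
    show "((\<lambda>t. \<psi>2 (\<phi> t) * (\<phi>1 t)\<^sup>2 + \<psi>1 (\<phi> t) * \<phi>2 t) has_real_derivative
        r * a ^ 3 + 3 * q * a * b + p * c) (at x)"
      using D \<phi>(3-) \<psi>(3-)
      by (auto intro!: derivative_eq_intros DERIV_chain2[of \<psi>1] DERIV_chain2[of \<psi>2]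
          simp: power2_eq_square power3_eq_cube algebra_simps)
  qed (use \<phi> \<psi> in auto)
qed

lemma eventually_slice_in_open:
  fixes x :: "'a::topological_space" and c :: "'b::topological_space"
  assumes "open U" "(x, c) \<in> U"
  shows "\<forall>\<^sub>F t in nhds x. (t, c) \<in> U"
proof -
  have "open ((\<lambda>t. (t, c)) -` U)"
    using \<open>open U\<close> by (intro open_vimage continuous_intros)
  then have "\<forall>\<^sub>F t in nhds x. t \<in> (\<lambda>t. (t, c)) -` U"
    using assms(2) by (intro eventually_nhds_in_open) auto
  then show ?thesis
    by simp
qed

lemma jet3_of_C_class_on:
  fixes f :: "real \<times> 'b::real_normed_vector \<Rightarrow> real"
  assumes "open U" "C_class_on 3 U f" "(x, c) \<in> U"
  shows "jet3 (\<lambda>t. f (t, c)) x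
    (pd_x f (x, c)) (pd_x (pd_x f) (x, c)) (pd_x (pd_x (pd_x f)) (x, c))"
proof -
  have C3: "C_class_on (Suc (Suc (Suc 0))) U f"
    using assms(2) by (simp add: numeral_3_eq_3)
  note C2 = C_class_on_pd_x[OF assms(1) C3]
  note C1 = C_class_on_pd_x[OF assms(1) C2]
  note U = eventually_slice_in_open[OF assms(1,3)]
  show ?thesis
    unfolding jet3_def
  proof (intro exI conjI)
    show "\<forall>\<^sub>F t in nhds x. ((\<lambda>t. f (t, c)) has_real_derivative pd_x f (t, c)) (at t)"
      using U by eventually_elim
        (intro has_real_derivative_pd_x C_class_on_imp_differentiable[OF C3])
    show "\<forall>\<^sub>F t in nhds x. ((\<lambda>t. pd_x f (t, c)) has_real_derivative pd_x (pd_x f) (t, c)) (at t)"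
      using U by eventually_elim
        (intro has_real_derivative_pd_x C_class_on_imp_differentiable[OF C2])
    show "((\<lambda>t. pd_x (pd_x f) (t, c)) has_real_derivative pd_x (pd_x (pd_x f)) (x, c)) (at x)"
      using assms(3) by (intro has_real_derivative_pd_x C_class_on_imp_differentiable[OF C1])
  qed auto
qed

section \<open>Implicit differentiation\<close>

lemma DERIV_eventually_zero:
  assumes "\<forall>\<^sub>F t in nhds x. \<phi> t = 0" "(\<phi> has_real_derivative d) (at x)"
  shows "d = 0"
proof -
  have "((\<lambda>_. 0) has_real_derivative d) (at x)"
    using assms DERIV_cong_ev[of x x \<phi> "\<lambda>_. 0" d d] by simp
  then show ?thesis
    using DERIV_const by (rule DERIV_unique)
qed

lemma eventually_DERIV_eventually_zero:
  assumes "\<forall>\<^sub>F t in nhds x. \<phi> t = 0" "\<forall>\<^sub>F t in nhds x. (\<phi> has_real_derivative d t) (at t)"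
  shows "\<forall>\<^sub>F t in nhds x. d t = 0"
proof -
  have "\<forall>\<^sub>F s in nhds x. \<forall>\<^sub>F t in nhds s. \<phi> t = 0"
    using assms(1) by (simp add: eventually_eventually)
  then show ?thesis
    using assms(2) by eventually_elim (rule DERIV_eventually_zero)
qed

text \<open>
  The left-hand sides are the successive derivatives of \<open>t \<mapsto> F(t, g(t), c)\<close>. The first two
  vanish in a neighbourhood of \<open>x\<close>, which is what permits differentiating them again.
\<close>

proposition implicit_jet3_equations:
  fixes F :: "real \<times> real \<times> 'b::real_normed_vector \<Rightarrow> real"
  assumes F: "C_class_on 3 UNIV F"
    and g: "jet3 g x p q r"
    and zero: "\<forall>\<^sub>F t in nhds x. F (t, g t, c) = 0"
  defines "w \<equiv> (x, g x, c)"
  shows "pd_x F w + pd_y F w * p = 0"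
    and "pd_x (pd_x F) w + 2 * pd_y (pd_x F) w * p + pd_y (pd_y F) w * p\<^sup>2 + pd_y F w * q = 0"
    and "pd_x (pd_x (pd_x F)) w + 3 * pd_y (pd_x (pd_x F)) w * p
      + 3 * pd_y (pd_y (pd_x F)) w * p\<^sup>2 + pd_y (pd_y (pd_y F)) w * p ^ 3
      + 3 * (pd_y (pd_x F) w + pd_y (pd_y F) w * p) * q + pd_y F w * r = 0"
proof -
  have C3: "C_class_on (Suc (Suc (Suc 0))) UNIV F"
    using F by (simp add: numeral_3_eq_3)
  note Cx = C_class_on_pd_x[OF open_UNIV C3] and Cy = C_class_on_pd_y[OF open_UNIV C3]
  note Cxx = C_class_on_pd_x[OF open_UNIV Cx] and Cxy = C_class_on_pd_y[OF open_UNIV Cx]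
    and Cyy = C_class_on_pd_y[OF open_UNIV Cy]
  note diff = C3[THEN C_class_on_imp_differentiable, OF UNIV_I]
    Cx[THEN C_class_on_imp_differentiable, OF UNIV_I]
    Cy[THEN C_class_on_imp_differentiable, OF UNIV_I]
    Cxx[THEN C_class_on_imp_differentiable, OF UNIV_I]
    Cxy[THEN C_class_on_imp_differentiable, OF UNIV_I]
    Cyy[THEN C_class_on_imp_differentiable, OF UNIV_I]
  \<comment> \<open>Rewriting with these moves all the \<open>y\<close>-derivatives outside the \<open>x\<close>-derivatives.\<close>
  note comm = pd_x_pd_y_commute[OF C3] pd_x_pd_y_commute[OF Cx] pd_x_pd_y_commute[OF Cy]
  obtain g1 g2 where
    1: "\<forall>\<^sub>F t in nhds x. (g has_real_derivative g1 t) (at t)" and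
    2: "\<forall>\<^sub>F t in nhds x. (g1 has_real_derivative g2 t) (at t)" and
    3: "(g2 has_real_derivative r) (at x)" "g1 x = p" "g2 x = q"
    using g unfolding jet3_def by blast
  let ?w = "\<lambda>t. (t, g t, c)"
  have R1: "\<forall>\<^sub>F t in nhds x. pd_x F (?w t) + pd_y F (?w t) * g1 t = 0"
    by (rule eventually_DERIV_eventually_zero[OF zero], use 1 in eventually_elim)
      (intro has_real_derivative_along_graph diff)
  have "\<forall>\<^sub>F t in nhds x. ((\<lambda>t. pd_x F (?w t) + pd_y F (?w t) * g1 t) has_real_derivative
      pd_x (pd_x F) (?w t) + 2 * pd_y (pd_x F) (?w t) * g1 t + pd_y (pd_y F) (?w t) * (g1 t)\<^sup>2
        + pd_y F (?w t) * g2 t) (at t)"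
    using 1 2
  proof eventually_elim
    case (elim t)
    note [derivative_intros] = has_real_derivative_along_graph[OF diff(2) elim(1)]
      has_real_derivative_along_graph[OF diff(3) elim(1)] elim
    show ?case
      by (rule derivative_eq_intros refl)+ (simp add: comm power2_eq_square algebra_simps)
  qed
  then have R2: "\<forall>\<^sub>F t in nhds x. pd_x (pd_x F) (?w t) + 2 * pd_y (pd_x F) (?w t) * g1 t
      + pd_y (pd_y F) (?w t) * (g1 t)\<^sup>2 + pd_y F (?w t) * g2 t = 0"
    by (rule eventually_DERIV_eventually_zero[OF R1])
  show "pd_x F w + pd_y F w * p = 0"
    using eventually_nhds_x_imp_x[OF R1] 3 unfolding w_def by simp
  show "pd_x (pd_x F) w + 2 * pd_y (pd_x F) w * p + pd_y (pd_y F) w * p\<^sup>2 + pd_y F w * q = 0"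
    using eventually_nhds_x_imp_x[OF R2] 3 unfolding w_def by simp
  have D: "(g has_real_derivative g1 x) (at x)" "(g1 has_real_derivative g2 x) (at x)"
    using eventually_nhds_x_imp_x[OF 1] eventually_nhds_x_imp_x[OF 2] by auto
  note [derivative_intros] = has_real_derivative_along_graph[OF diff(3) D(1)]
    has_real_derivative_along_graph[OF diff(4) D(1)]
    has_real_derivative_along_graph[OF diff(5) D(1)]
    has_real_derivative_along_graph[OF diff(6) D(1)] D 3(1)
  show "pd_x (pd_x (pd_x F)) w + 3 * pd_y (pd_x (pd_x F)) w * p
      + 3 * pd_y (pd_y (pd_x F)) w * p\<^sup>2 + pd_y (pd_y (pd_y F)) w * p ^ 3
      + 3 * (pd_y (pd_x F) w + pd_y (pd_y F) w * p) * q + pd_y F w * r = 0"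
    by (rule DERIV_eventually_zero[OF R2], (rule derivative_eq_intros refl)+)
      (simp add: comm w_def 3(2,3)[symmetric] power2_eq_square power3_eq_cube algebra_simps)
qed

text \<open>
  With \<open>p\<close>, \<open>q\<close>, \<open>r\<close> the derivatives of the function \<open>g\<close> defined by \<open>F(x, g(x)) = 0\<close>, these are
  \<open>(log \<bar>g'\<bar>)'\<close> and \<open>(log \<bar>g'\<bar>)''\<close> in terms of \<open>F\<close>. In the second one, writing
  \<open>N = Fxx - 2 Fxy \<nu> + Fyy \<nu>\<^sup>2\<close>, the expression over \<open>Fx\<^sup>2\<close> arises as
  \<open>- N (N + 3 Fxy \<nu> - 3 Fyy \<nu>\<^sup>2)\<close>: the term \<open>- N\<^sup>2\<close> comes from the square of \<open>q / p = N / Fx\<close>,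
  and the others from the products of \<open>q\<close> with second derivatives of \<open>F\<close> in the third equation.
\<close>

lemma implicit_log_derivatives:
  fixes Fx Fy Fxx Fxy Fyy Fxxx Fxxy Fxyy Fyyy p q r :: real
  assumes eq1: "Fx + Fy * p = 0"
    and eq2: "Fxx + 2 * Fxy * p + Fyy * p\<^sup>2 + Fy * q = 0"
    and eq3: "Fxxx + 3 * Fxxy * p + 3 * Fxyy * p\<^sup>2 + Fyyy * p ^ 3
      + 3 * (Fxy + Fyy * p) * q + Fy * r = 0"
    and nz: "Fx \<noteq> 0" "Fy \<noteq> 0"
  defines "\<nu> \<equiv> Fx / Fy"
  shows "q / p = (Fxx - 2 * Fxy * \<nu> + Fyy * \<nu>\<^sup>2) / Fx"
    and "r / p - (q / p)\<^sup>2 = (Fxxx - 3 * Fxxy * \<nu> + 3 * Fxyy * \<nu>\<^sup>2 - Fyyy * \<nu> ^ 3) / Fx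
      + (- (Fxx\<^sup>2) + Fxx * Fxy * \<nu> + (Fxx * Fyy + 2 * Fxy\<^sup>2) * \<nu>\<^sup>2
          - 5 * Fxy * Fyy * \<nu> ^ 3 + 2 * Fyy\<^sup>2 * \<nu> ^ 4) / Fx\<^sup>2"
proof -
  define N where "N = Fxx - 2 * Fxy * \<nu> + Fyy * \<nu>\<^sup>2"
  define T where "T = Fxxx - 3 * Fxxy * \<nu> + 3 * Fxyy * \<nu>\<^sup>2 - Fyyy * \<nu> ^ 3"
  have p: "p = - \<nu>"
    using eq1 nz by (simp add: \<nu>_def field_simps)
  have "\<nu> \<noteq> 0" "Fx = Fy * \<nu>"
    using nz by (simp_all add: \<nu>_def)
  have q: "Fy * q = - N"
    using eq2 unfolding p N_def by simp
  have qp: "q / p = N / Fx"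
    using q \<open>\<nu> \<noteq> 0\<close> nz unfolding p \<open>Fx = Fy * \<nu>\<close> by (simp add: field_simps)
  then show "q / p = (Fxx - 2 * Fxy * \<nu> + Fyy * \<nu>\<^sup>2) / Fx"
    unfolding N_def .
  have "Fy * r = - T - 3 * (Fxy - Fyy * \<nu>) * q"
    using eq3 unfolding p T_def by (simp add: algebra_simps)
  moreover have "q = - N * \<nu> / Fx"
    using qp \<open>\<nu> \<noteq> 0\<close> unfolding p by (simp add: field_simps)
  ultimately have "Fy * r = - T + 3 * (Fxy - Fyy * \<nu>) * (N * \<nu> / Fx)"
    by simp
  moreover have "r / p = - (Fy * r) / Fx"
    using \<open>\<nu> \<noteq> 0\<close> nz unfolding p \<open>Fx = Fy * \<nu>\<close> by (simp add: field_simps)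
  ultimately have "r / p = T / Fx - 3 * (Fxy - Fyy * \<nu>) * N * \<nu> / Fx\<^sup>2"
    by (simp add: diff_divide_distrib power2_eq_square)
  then have "r / p - (q / p)\<^sup>2 = T / Fx + (- N * (N + 3 * Fxy * \<nu> - 3 * Fyy * \<nu>\<^sup>2)) / Fx\<^sup>2"
    unfolding qp power_divide
    by (simp add: add_divide_distrib diff_divide_distrib power2_eq_square algebra_simps)
  also have "- N * (N + 3 * Fxy * \<nu> - 3 * Fyy * \<nu>\<^sup>2) =
      - (Fxx\<^sup>2) + Fxx * Fxy * \<nu> + (Fxx * Fyy + 2 * Fxy\<^sup>2) * \<nu>\<^sup>2
        - 5 * Fxy * Fyy * \<nu> ^ 3 + 2 * Fyy\<^sup>2 * \<nu> ^ 4"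
    unfolding N_def by algebra
  finally show "r / p - (q / p)\<^sup>2 = (Fxxx - 3 * Fxxy * \<nu> + 3 * Fxyy * \<nu>\<^sup>2 - Fyyy * \<nu> ^ 3) / Fx
      + (- (Fxx\<^sup>2) + Fxx * Fxy * \<nu> + (Fxx * Fyy + 2 * Fxy\<^sup>2) * \<nu>\<^sup>2
          - 5 * Fxy * Fyy * \<nu> ^ 3 + 2 * Fyy\<^sup>2 * \<nu> ^ 4) / Fx\<^sup>2"
    unfolding T_def .
qed

section \<open>Iteration\<close>

text \<open>
  If \<open>a\<close>, \<open>b\<close>, \<open>c\<close> are the first three derivatives of a function \<open>\<phi>\<close>, then
  \<open>c / a - (b / a)\<^sup>2\<close> is \<open>(log \<bar>\<phi>'\<bar>)''\<close>. Composition on the left with a map whose derivatives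
  are \<open>p\<close>, \<open>q\<close>, \<open>r\<close> adds \<open>(q / p) b + (r / p - (q / p)\<^sup>2) a\<^sup>2\<close> to it, hence the
  telescoping sum.
\<close>

lemma third_derivative_of_composition_chain:
  fixes a b c p q r :: "nat \<Rightarrow> real"
  assumes init: "b 0 = 0" "c 0 = 0"
    and a: "\<And>j. j < k \<Longrightarrow> a (Suc j) = p j * a j"
    and b: "\<And>j. j < k \<Longrightarrow> b (Suc j) = q j * (a j)\<^sup>2 + p j * b j"
    and c: "\<And>j. j < k \<Longrightarrow> c (Suc j) = r j * a j ^ 3 + 3 * q j * a j * b j + p j * c j"
    and nz: "a k \<noteq> 0"
  shows "c k = (b k)\<^sup>2 / a k + a k * (\<Sum>j<k. q j / p j * b j)
    + a k * (\<Sum>j<k. (r j / p j - (q j / p j)\<^sup>2) * (a j)\<^sup>2)"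
  using a b c nz
proof (induction k)
  case 0
  then show ?case by (simp add: init)
next
  case (Suc k)
  have nz: "p k \<noteq> 0" "a k \<noteq> 0"
    using Suc.prems(1)[of k] Suc.prems(4) by auto
  define S where "S = (\<Sum>j<k. q j / p j * b j) + (\<Sum>j<k. (r j / p j - (q j / p j)\<^sup>2) * (a j)\<^sup>2)"
  have IH: "c k = (b k)\<^sup>2 / a k + a k * S"
    using Suc nz by (simp add: S_def algebra_simps)
  have "c (Suc k) = (b (Suc k))\<^sup>2 / a (Suc k)
      + a (Suc k) * (S + q k / p k * b k + (r k / p k - (q k / p k)\<^sup>2) * (a k)\<^sup>2)"
    using nz unfolding Suc.prems(1-3)[of k, OF lessI] IH
    by (simp add: field_simps power2_eq_square power3_eq_cube)
  then show ?case
    by (simp add: S_def algebra_simps)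
qed

lemma pd_x_iter_jet3:
  assumes "jet3 (\<lambda>t. iter f j (t, \<alpha>)) x a b c"
  shows "pd_x (iter f j) (x, \<alpha>) = a" "pd_x (pd_x (iter f j)) (x, \<alpha>) = b"
    "pd_x (pd_x (pd_x (iter f j))) (x, \<alpha>) = c"
  using jet3_imp_deriv[OF assms] by (simp_all add: pd_x_def)

lemma jet3_iter:
  assumes "open U" "C_class_on 3 U f" "\<And>i. i < j \<Longrightarrow> (iter f i (x, \<alpha>), \<alpha>) \<in> U"
  shows "jet3 (\<lambda>t. iter f j (t, \<alpha>)) x (pd_x (iter f j) (x, \<alpha>))
    (pd_x (pd_x (iter f j)) (x, \<alpha>)) (pd_x (pd_x (pd_x (iter f j))) (x, \<alpha>))"
proof -
  have "\<exists>a b c. jet3 (\<lambda>t. iter f j (t, \<alpha>)) x a b c"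
    using assms(3)
  proof (induction j)
    case 0
    then show ?case using jet3_ident by auto
  next
    case (Suc j)
    then obtain a b c where "jet3 (\<lambda>t. iter f j (t, \<alpha>)) x a b c"
      by force
    from jet3_compose[OF this jet3_of_C_class_on[OF assms(1,2) Suc.prems[OF lessI]]] show ?case
      by auto
  qed
  then show ?thesis
    using pd_x_iter_jet3 by metis
qed

lemma pd_x_iter_0:
  "pd_x (iter f 0) (x, \<alpha>) = 1" "pd_x (pd_x (iter f 0)) (x, \<alpha>) = 0"
  "pd_x (pd_x (pd_x (iter f 0))) (x, \<alpha>) = 0"
  using pd_x_iter_jet3[of f 0 \<alpha> x 1 0 0] jet3_ident[of x] by simp_all

lemma pd_x_iter_Suc:
  fixes f :: "real \<times> real \<Rightarrow> real"
  assumes "open U" "C_class_on 3 U f" "\<And>i. i \<le> j \<Longrightarrow> (iter f i (x, \<alpha>), \<alpha>) \<in> U"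
  defines "u \<equiv> (iter f j (x, \<alpha>), \<alpha>)"
  defines "a \<equiv> pd_x (iter f j) (x, \<alpha>)" and "b \<equiv> pd_x (pd_x (iter f j)) (x, \<alpha>)"
    and "c \<equiv> pd_x (pd_x (pd_x (iter f j))) (x, \<alpha>)"
  shows "pd_x (iter f (Suc j)) (x, \<alpha>) = pd_x f u * a"
    and "pd_x (pd_x (iter f (Suc j))) (x, \<alpha>) = pd_x (pd_x f) u * a\<^sup>2 + pd_x f u * b"
    and "pd_x (pd_x (pd_x (iter f (Suc j)))) (x, \<alpha>) =
      pd_x (pd_x (pd_x f)) u * a ^ 3 + 3 * pd_x (pd_x f) u * a * b + pd_x f u * c"
proof -
  have "jet3 (\<lambda>t. iter f j (t, \<alpha>)) x a b c"
    unfolding a_def b_def c_def using assms(3) by (intro jet3_iter[OF assms(1,2)]) auto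
  moreover have "jet3 (\<lambda>t. f (t, \<alpha>)) (iter f j (x, \<alpha>))
      (pd_x f u) (pd_x (pd_x f) u) (pd_x (pd_x (pd_x f)) u)"
    unfolding u_def using assms(3) by (intro jet3_of_C_class_on[OF assms(1,2)]) auto
  ultimately have "jet3 (\<lambda>t. iter f (Suc j) (t, \<alpha>)) x (pd_x f u * a)
      (pd_x (pd_x f) u * a\<^sup>2 + pd_x f u * b)
      (pd_x (pd_x (pd_x f)) u * a ^ 3 + 3 * pd_x (pd_x f) u * a * b + pd_x f u * c)"
    using jet3_compose[of "\<lambda>t. iter f j (t, \<alpha>)"] by simp
  note pd_x_iter_jet3[OF this]
  then show "pd_x (iter f (Suc j)) (x, \<alpha>) = pd_x f u * a"
    and "pd_x (pd_x (iter f (Suc j))) (x, \<alpha>) = pd_x (pd_x f) u * a\<^sup>2 + pd_x f u * b"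
    and "pd_x (pd_x (pd_x (iter f (Suc j)))) (x, \<alpha>) =
      pd_x (pd_x (pd_x f)) u * a ^ 3 + 3 * pd_x (pd_x f) u * a * b + pd_x f u * c" .
qed

lemma implicit_derivative_equations:
  fixes F :: "real \<times> real \<times> real \<Rightarrow> real"
  assumes "C_class_on 3 UNIV F" "open U" "C_class_on 3 U f"
    and zero: "\<forall>x \<alpha>. (x, \<alpha>) \<in> U \<longrightarrow> F (x, f (x, \<alpha>), \<alpha>) = 0"
    and "(y, \<alpha>) \<in> U"
  defines "w \<equiv> (y, f (y, \<alpha>), \<alpha>)"
    and "p \<equiv> pd_x f (y, \<alpha>)" and "q \<equiv> pd_x (pd_x f) (y, \<alpha>)"
    and "r \<equiv> pd_x (pd_x (pd_x f)) (y, \<alpha>)"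
  shows "pd_x F w + pd_y F w * p = 0"
    and "pd_x (pd_x F) w + 2 * pd_y (pd_x F) w * p + pd_y (pd_y F) w * p\<^sup>2 + pd_y F w * q = 0"
    and "pd_x (pd_x (pd_x F)) w + 3 * pd_y (pd_x (pd_x F)) w * p
      + 3 * pd_y (pd_y (pd_x F)) w * p\<^sup>2 + pd_y (pd_y (pd_y F)) w * p ^ 3
      + 3 * (pd_y (pd_x F) w + pd_y (pd_y F) w * p) * q + pd_y F w * r = 0"
proof -
  have jet: "jet3 (\<lambda>t. f (t, \<alpha>)) y p q r"
    unfolding p_def q_def r_def using assms by (intro jet3_of_C_class_on)
  have "\<forall>\<^sub>F t in nhds y. F (t, f (t, \<alpha>), \<alpha>) = 0"
    using eventually_slice_in_open[OF \<open>open U\<close> \<open>(y, \<alpha>) \<in> U\<close>]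
    by eventually_elim (use zero in blast)
  note implicit_jet3_equations[OF assms(1) jet this]
  then show "pd_x F w + pd_y F w * p = 0"
    and "pd_x (pd_x F) w + 2 * pd_y (pd_x F) w * p + pd_y (pd_y F) w * p\<^sup>2 + pd_y F w * q = 0"
    and "pd_x (pd_x (pd_x F)) w + 3 * pd_y (pd_x (pd_x F)) w * p
      + 3 * pd_y (pd_y (pd_x F)) w * p\<^sup>2 + pd_y (pd_y (pd_y F)) w * p ^ 3
      + 3 * (pd_y (pd_x F) w + pd_y (pd_y F) w * p) * q + pd_y F w * r = 0"
    unfolding w_def .
qed

text \<open>
  By the chain rule \<open>\<partial>\<^sub>x f\<^sup>k\<close> is the product of the factors \<open>- F\<^sub>x / F\<^sub>y\<close> along the orbit.
\<close>

lemma pd_x_iter_nonzero_iff: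
  fixes F :: "real \<times> real \<times> real \<Rightarrow> real"
  assumes "C_class_on 3 UNIV F" "open U" "C_class_on 3 U f"
    and "\<forall>x \<alpha>. (x, \<alpha>) \<in> U \<longrightarrow> F (x, f (x, \<alpha>), \<alpha>) = 0"
    and "\<And>j. j < k \<Longrightarrow> (iter f j (x, \<alpha>), \<alpha>) \<in> U"
    and "\<And>j. j < k \<Longrightarrow> pd_y F (iter f j (x, \<alpha>), iter f (Suc j) (x, \<alpha>), \<alpha>) \<noteq> 0"
  shows "pd_x (iter f k) (x, \<alpha>) \<noteq> 0 \<longleftrightarrow>
    (\<forall>j<k. pd_x F (iter f j (x, \<alpha>), iter f (Suc j) (x, \<alpha>), \<alpha>) \<noteq> 0)"
  using assms(5,6)
proof (induction k)
  case 0
  then show ?case by (simp only: pd_x_iter_0) simp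
next
  case (Suc k)
  have IH: "pd_x (iter f k) (x, \<alpha>) \<noteq> 0 \<longleftrightarrow>
      (\<forall>j<k. pd_x F (iter f j (x, \<alpha>), iter f (Suc j) (x, \<alpha>), \<alpha>) \<noteq> 0)"
    using Suc by auto
  have "pd_x (iter f (Suc k)) (x, \<alpha>) = pd_x f (iter f k (x, \<alpha>), \<alpha>) * pd_x (iter f k) (x, \<alpha>)"
    using Suc.prems(1) by (intro pd_x_iter_Suc[OF assms(2,3)]) auto
  moreover have "pd_x f (iter f k (x, \<alpha>), \<alpha>) \<noteq> 0 \<longleftrightarrow>
      pd_x F (iter f k (x, \<alpha>), iter f (Suc k) (x, \<alpha>), \<alpha>) \<noteq> 0"
    using implicit_derivative_equations(1)[OF assms(1-4) Suc.prems(1)[OF lessI]]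
      Suc.prems(2)[OF lessI]
    by auto
  ultimately show ?case
    by (auto simp: IH less_Suc_eq simp del: iter.simps)
qed

text \<open>
  The factor \<open>\<partial>\<^sub>x f\<^sup>k\<close> only has to be nonzero for the third derivative to be expressed through
  logarithmic derivatives. This one condition covers both parts of the theorem: orbits with
  \<open>F\<^sub>x \<noteq> 0\<close>, and cycles with multiplier \<open>1\<close> or \<open>- 1\<close>.
\<close>

lemma third_derivative_iter:
  fixes F :: "real \<times> real \<times> real \<Rightarrow> real"
  assumes F: "C_class_on 3 UNIV F" and U: "open U" and f: "C_class_on 3 U f"
    and zero: "\<forall>x \<alpha>. (x, \<alpha>) \<in> U \<longrightarrow> F (x, f (x, \<alpha>), \<alpha>) = 0"
    and orbit: "\<And>j. j < k \<Longrightarrow> (iter f j (x, \<alpha>), \<alpha>) \<in> U"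
    and Fy_nz: "\<And>j. j < k \<Longrightarrow> pd_y F (iter f j (x, \<alpha>), iter f (Suc j) (x, \<alpha>), \<alpha>) \<noteq> 0"
    and nz: "pd_x (iter f k) (x, \<alpha>) \<noteq> 0"
  defines "w \<equiv> \<lambda>j. (iter f j (x, \<alpha>), iter f (Suc j) (x, \<alpha>), \<alpha>)"
  defines "Fx \<equiv> \<lambda>j. pd_x F (w j)" and "Fy \<equiv> \<lambda>j. pd_y F (w j)"
    and "Fxx \<equiv> \<lambda>j. pd_x (pd_x F) (w j)" and "Fxy \<equiv> \<lambda>j. pd_y (pd_x F) (w j)"
    and "Fyy \<equiv> \<lambda>j. pd_y (pd_y F) (w j)" and "Fxxx \<equiv> \<lambda>j. pd_x (pd_x (pd_x F)) (w j)"
    and "Fxxy \<equiv> \<lambda>j. pd_y (pd_x (pd_x F)) (w j)" and "Fxyy \<equiv> \<lambda>j. pd_y (pd_y (pd_x F)) (w j)"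
    and "Fyyy \<equiv> \<lambda>j. pd_y (pd_y (pd_y F)) (w j)"
    and "D1 \<equiv> \<lambda>j. pd_x (iter f j) (x, \<alpha>)" and "D2 \<equiv> \<lambda>j. pd_x (pd_x (iter f j)) (x, \<alpha>)"
    and "D3 \<equiv> \<lambda>j. pd_x (pd_x (pd_x (iter f j))) (x, \<alpha>)"
  defines "\<nu> \<equiv> \<lambda>j. Fx j / Fy j"
  shows "D3 k = (D2 k)\<^sup>2 / D1 k
    + D1 k * (\<Sum>j<k. (Fxx j - 2 * Fxy j * \<nu> j + Fyy j * (\<nu> j)\<^sup>2) / Fx j * D2 j)
    + D1 k * (\<Sum>j<k. (Fxxx j - 3 * Fxxy j * \<nu> j + 3 * Fxyy j * (\<nu> j)\<^sup>2
        - Fyyy j * (\<nu> j) ^ 3) / Fx j * (D1 j)\<^sup>2)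
    + D1 k * (\<Sum>j<k. (- ((Fxx j)\<^sup>2) + Fxx j * Fxy j * \<nu> j
        + (Fxx j * Fyy j + 2 * (Fxy j)\<^sup>2) * (\<nu> j)\<^sup>2
        - 5 * Fxy j * Fyy j * (\<nu> j) ^ 3 + 2 * (Fyy j)\<^sup>2 * (\<nu> j) ^ 4) / (Fx j)\<^sup>2 * (D1 j)\<^sup>2)"
proof -
  define u where "u j = (iter f j (x, \<alpha>), \<alpha>)" for j
  define p q r where "p j = pd_x f (u j)" and "q j = pd_x (pd_x f) (u j)"
    and "r j = pd_x (pd_x (pd_x f)) (u j)" for j
  have Fx_nz: "Fx j \<noteq> 0" if "j < k" for j
    using pd_x_iter_nonzero_iff[OF F U f zero orbit Fy_nz] nz that unfolding Fx_def w_def by blast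
  have Fy_nz': "Fy j \<noteq> 0" if "j < k" for j
    using Fy_nz[OF that] unfolding Fy_def w_def .
  have w: "w j = (iter f j (x, \<alpha>), f (iter f j (x, \<alpha>), \<alpha>), \<alpha>)" for j
    by (simp add: w_def)
  define A where "A j = (Fxx j - 2 * Fxy j * \<nu> j + Fyy j * (\<nu> j)\<^sup>2) / Fx j" for j
  define B where "B j = (Fxxx j - 3 * Fxxy j * \<nu> j + 3 * Fxyy j * (\<nu> j)\<^sup>2
    - Fyyy j * (\<nu> j) ^ 3) / Fx j" for j
  define C where "C j = (- ((Fxx j)\<^sup>2) + Fxx j * Fxy j * \<nu> j
    + (Fxx j * Fyy j + 2 * (Fxy j)\<^sup>2) * (\<nu> j)\<^sup>2
    - 5 * Fxy j * Fyy j * (\<nu> j) ^ 3 + 2 * (Fyy j)\<^sup>2 * (\<nu> j) ^ 4) / (Fx j)\<^sup>2" for j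
  have log_derivs: "q j / p j = A j" "r j / p j - (q j / p j)\<^sup>2 = B j + C j"
    if "j < k" for j
  proof -
    note log_derivs = implicit_log_derivatives[OF
        implicit_derivative_equations[OF F U f zero orbit[OF that], folded w u_def]
        Fx_nz[OF that, unfolded Fx_def] Fy_nz'[OF that, unfolded Fy_def]]
    note defs = A_def B_def C_def \<nu>_def Fx_def Fy_def Fxx_def Fxy_def Fyy_def
      Fxxx_def Fxxy_def Fxyy_def Fyyy_def p_def q_def r_def
    show "q j / p j = A j"
      unfolding defs by (rule log_derivs(1))
    show "r j / p j - (q j / p j)\<^sup>2 = B j + C j"
      unfolding defs by (rule log_derivs(2))
  qed
  have "D3 k = (D2 k)\<^sup>2 / D1 k + D1 k * (\<Sum>j<k. q j / p j * D2 j)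
      + D1 k * (\<Sum>j<k. (r j / p j - (q j / p j)\<^sup>2) * (D1 j)\<^sup>2)"
  proof (rule third_derivative_of_composition_chain)
    show "D2 0 = 0" "D3 0 = 0"
      unfolding D2_def D3_def by (rule pd_x_iter_0)+
    show "D1 k \<noteq> 0"
      using nz by (simp add: D1_def)
    fix j assume "j < k"
    then have "(iter f i (x, \<alpha>), \<alpha>) \<in> U" if "i \<le> j" for i
      using that orbit by simp
    note pd_x_iter_Suc[OF U f this]
    then show "D1 (Suc j) = p j * D1 j" "D2 (Suc j) = q j * (D1 j)\<^sup>2 + p j * D2 j"
      "D3 (Suc j) = r j * D1 j ^ 3 + 3 * q j * D1 j * D2 j + p j * D3 j"
      unfolding D1_def D2_def D3_def p_def q_def r_def u_def by blast+
  qed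
  also have "(\<Sum>j<k. q j / p j * D2 j) = (\<Sum>j<k. A j * D2 j)"
    by (rule sum.cong) (simp_all only: lessThan_iff log_derivs)
  also have "(\<Sum>j<k. (r j / p j - (q j / p j)\<^sup>2) * (D1 j)\<^sup>2) =
      (\<Sum>j<k. B j * (D1 j)\<^sup>2) + (\<Sum>j<k. C j * (D1 j)\<^sup>2)"
    unfolding sum.distrib[symmetric]
    by (rule sum.cong) (simp_all only: lessThan_iff log_derivs(2) distrib_right)
  finally show ?thesis
    unfolding A_def B_def C_def by (simp only: distrib_left add.assoc)
qed

theorem proposition3p7:
  fixes F :: "real \<times> real \<times> real \<Rightarrow> real"
    and f :: "real \<times> real \<Rightarrow> real"
    and U :: "(real \<times> real) set"
  assumes F_C3: "C_class_on 3 UNIV F"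
    and U_open: "open U"
    and f_C3: "C_class_on 3 U f"
    and implicit: "\<And>x \<alpha>. (x, \<alpha>) \<in> U \<Longrightarrow> F (x, f (x, \<alpha>), \<alpha>) = 0"
  shows
    "(\<forall>(k::nat) (x::real) (\<alpha>::real).
        k \<ge> 1 \<longrightarrow>
        (\<forall>j<k. (iter f j (x, \<alpha>), \<alpha>) \<in> U) \<longrightarrow>
        (\<forall>j<k. pd_y F (iter f j (x, \<alpha>), iter f (Suc j) (x, \<alpha>), \<alpha>) \<noteq> 0) \<longrightarrow>
        (\<forall>j<k. pd_x F (iter f j (x, \<alpha>), iter f (Suc j) (x, \<alpha>), \<alpha>) \<noteq> 0) \<longrightarrow>
        (let w = (\<lambda>j. (iter f j (x, \<alpha>), iter f (Suc j) (x, \<alpha>), \<alpha>));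
           Fx = (\<lambda>j. pd_x F (w j));
           Fy = (\<lambda>j. pd_y F (w j));
           Fxx = (\<lambda>j. pd_x (pd_x F) (w j));
           Fxy = (\<lambda>j. pd_y (pd_x F) (w j));
           Fyy = (\<lambda>j. pd_y (pd_y F) (w j));
           Fxxx = (\<lambda>j. pd_x (pd_x (pd_x F)) (w j));
           Fxxy = (\<lambda>j. pd_y (pd_x (pd_x F)) (w j));
           Fxyy = (\<lambda>j. pd_y (pd_y (pd_x F)) (w j));
           Fyyy = (\<lambda>j. pd_y (pd_y (pd_y F)) (w j));
           \<nu> = (\<lambda>j. Fx j / Fy j);
           D1 = (\<lambda>j. pd_x (iter f j) (x, \<alpha>));
           D2 = (\<lambda>j. pd_x (pd_x (iter f j)) (x, \<alpha>));
           D3 = (\<lambda>j. pd_x (pd_x (pd_x (iter f j))) (x, \<alpha>))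
         in D3 k = (D2 k)^2 / D1 k
         + D1 k * (\<Sum>j<k. (Fxx j - 2 * Fxy j * \<nu> j + Fyy j * (\<nu> j)^2) / Fx j * D2 j)
         + D1 k * (\<Sum>j<k. (Fxxx j - 3 * Fxxy j * \<nu> j + 3 * Fxyy j * (\<nu> j)^2
                         - Fyyy j * (\<nu> j)^3) / Fx j * (D1 j)^2)
         + D1 k * (\<Sum>j<k. (- ((Fxx j)^2) + Fxx j * Fxy j * \<nu> j
                         + (Fxx j * Fyy j + 2 * (Fxy j)^2) * (\<nu> j)^2
                         - 5 * Fxy j * Fyy j * (\<nu> j)^3 + 2 * (Fyy j)^2 * (\<nu> j)^4) * (D1 j / Fx j)^2)))
     \<and>
     (\<forall>(p::nat) (x::nat \<Rightarrow> real) (\<alpha>::real) (\<epsilon>::real).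
        p \<ge> 1 \<longrightarrow>
        (\<forall>j\<le>p. x j = iter f j (x 0, \<alpha>)) \<longrightarrow>
        (\<forall>j<p. (x j, \<alpha>) \<in> U) \<longrightarrow>
        x p = x 0 \<longrightarrow>
        (\<forall>j<p. pd_y F (x j, x (Suc j), \<alpha>) \<noteq> 0) \<longrightarrow>
        \<epsilon> \<in> {1, - 1} \<longrightarrow>
        pd_x (iter f p) (x 0, \<alpha>) = \<epsilon> \<longrightarrow>
        (let w = (\<lambda>j. (x j, x (Suc j), \<alpha>));
           Fx = (\<lambda>j. pd_x F (w j));
           Fy = (\<lambda>j. pd_y F (w j));
           Fxx = (\<lambda>j. pd_x (pd_x F) (w j));
           Fxy = (\<lambda>j. pd_y (pd_x F) (w j));
           Fyy = (\<lambda>j. pd_y (pd_y F) (w j));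
           Fxxx = (\<lambda>j. pd_x (pd_x (pd_x F)) (w j));
           Fxxy = (\<lambda>j. pd_y (pd_x (pd_x F)) (w j));
           Fxyy = (\<lambda>j. pd_y (pd_y (pd_x F)) (w j));
           Fyyy = (\<lambda>j. pd_y (pd_y (pd_y F)) (w j));
           \<nu> = (\<lambda>j. Fx j / Fy j);
           D1 = (\<lambda>j. pd_x (iter f j) (x 0, \<alpha>));
           D2 = (\<lambda>j. pd_x (pd_x (iter f j)) (x 0, \<alpha>));
           D3 = (\<lambda>j. pd_x (pd_x (pd_x (iter f j))) (x 0, \<alpha>))
         in D3 p = \<epsilon> * (D2 p)^2
         + \<epsilon> * (\<Sum>j<p. (Fxx j - 2 * Fxy j * \<nu> j + Fyy j * (\<nu> j)^2) / Fx j * D2 j)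
         + \<epsilon> * (\<Sum>j<p. (Fxxx j - 3 * Fxxy j * \<nu> j + 3 * Fxyy j * (\<nu> j)^2
                         - Fyyy j * (\<nu> j)^3) / Fx j * (D1 j)^2)
         + \<epsilon> * (\<Sum>j<p. (- ((Fxx j)^2) + Fxx j * Fxy j * \<nu> j
                         + (Fxx j * Fyy j + 2 * (Fxy j)^2) * (\<nu> j)^2
                         - 5 * Fxy j * Fyy j * (\<nu> j)^3 + 2 * (Fyy j)^2 * (\<nu> j)^4) / (Fx j)^2 * (D1 j)^2)))"
proof -
  have zero: "\<forall>x \<alpha>. (x, \<alpha>) \<in> U \<longrightarrow> F (x, f (x, \<alpha>), \<alpha>) = 0"
    using implicit by blast
  show ?thesis
  proof (intro conjI allI impI, goal_cases)
    case (1 k x \<alpha>)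
    have orbit: "(iter f j (x, \<alpha>), \<alpha>) \<in> U"
        "pd_y F (iter f j (x, \<alpha>), iter f (Suc j) (x, \<alpha>), \<alpha>) \<noteq> 0" if "j < k" for j
      using 1 that by blast+
    have nz: "pd_x (iter f k) (x, \<alpha>) \<noteq> 0"
      using 1 pd_x_iter_nonzero_iff[OF F_C3 U_open f_C3 zero orbit] by blast
    have sq: "y * (pd_x (iter f j) (x, \<alpha>) / z)\<^sup>2 = y / z\<^sup>2 * (pd_x (iter f j) (x, \<alpha>))\<^sup>2"
      for y z j
      by (simp add: power_divide)
    show ?case
      unfolding Let_def sq by (rule third_derivative_iter[OF F_C3 U_open f_C3 zero orbit nz])
  next
    case (2 p x \<alpha> \<epsilon>)
    have x: "x j = iter f j (x 0, \<alpha>)" if "j \<le> p" for j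
      using 2(2) that by blast
    have nz: "pd_x (iter f p) (x 0, \<alpha>) \<noteq> 0" and \<epsilon>: "inverse \<epsilon> = \<epsilon>"
      using 2(6,7) by auto
    \<comment> \<open>An instance per index: as a rewrite rule, \<open>x\<close> would keep unfolding the \<open>x 0\<close> on its right.\<close>
    have w: "(x j, x (Suc j), \<alpha>) = (iter f j (x 0, \<alpha>), iter f (Suc j) (x 0, \<alpha>), \<alpha>)"
      if "j \<in> {..<p}" for j
      using that x[of j] x[of "Suc j"] by (metis Suc_leI lessThan_iff less_imp_le)
    have orbit: "(iter f j (x 0, \<alpha>), \<alpha>) \<in> U"
        "pd_y F (iter f j (x 0, \<alpha>), iter f (Suc j) (x 0, \<alpha>), \<alpha>) \<noteq> 0" if "j < p" for j
      using 2(3,5) that x[of j] w[of j] by (metis less_imp_le, metis lessThan_iff)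
    have div: "y / \<epsilon> = \<epsilon> * y" for y
      using \<epsilon> by (simp add: divide_inverse)
    show ?case
      using third_derivative_iter[OF F_C3 U_open f_C3 zero orbit nz]
      unfolding Let_def \<open>pd_x (iter f p) (x 0, \<alpha>) = \<epsilon>\<close> div
      by (simp only: w cong: sum.cong)
  qed
qed

end
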